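(* Let $G$ be a $(d,s)$-edge colorable graph of order $n$, and let $h$ be a standard coloring of $G$. If $s\ge 11$ and for some constant $c>0$ we have $$\frac12\left(2^{-11}c^{-1}s^2d^{-1}\right)^{2^{-9}d^{-1}s^2}\ge n,$$ then any $\frac{c}{s}$-sparse list assignment $L$ for $G$ (with respect to $h$) is avoidable.
   Context: Graphs are finite and simple; the order of a graph is its number of vertices. A cycle in an edge-colored graph is $2$-colored if its edges are properly colored by two distinct colors (so a $4$-cycle is $2$-colored if its edges alternate between two distinct colors). For integers $d,s$, a $d$-regular graph $G$ is $(d,s)$-edge colorable if it admits a proper $d$-edge coloring $h$ in which every edge of $G$ is contained in at least $s-1$ $2$-colored $4$-cycles (necessarily $s\le d$). Such a coloring $h$ is called a standard coloring; it is fixed and uses the colors $\{1,\dots,d\}$. A standard matching of $G$ is a maximum set of edges all having the same color under $h$, i.e. a color class of $h$. The distance between two edges $e,e'$ is the number of edges in a shortest path between an endpoint of $e$ and an endpoint of $e'$. The $t$-neighborhood of an edge $e$ is the graph induced by all edges at distance at most $t$ from $e$. A list assignment $L$ for $G$ (assigning to each edge $e$ a possibly empty set $L(e)\subseteq\{1,\dots,d\}$ of forbidden colors) is $\beta$-sparse if (i) $|L(e)|\le \beta s$ for each edge $e$; (ii) for every vertex $v$, each color in $\{1,\dots,d\}$ occurs in at most $\beta s$ lists of edges incident to $v$; (iii) for every $6$-neighborhood $W$ (of any edge) and every standard matching $M$, any color appears at most $\beta s$ times in lists of edges of $M$ contained in $W$. $L$ is avoidable if there is a proper $d$-edge coloring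 $\varphi$ of $G$ with colors $\{1,\dots,d\}$ such that $\varphi(e)\notin L(e)$ for every edge $e$. *)

theory Defs
  imports Complex_Main "HOL-Library.Extended_Nat"
begin

text \<open>
  A graph is given by its vertex set \<open>V\<close> and its set \<open>E\<close> of edges, an edge being the
  two-element set of its endpoints.  Colors are natural numbers.
\<close>

definition simple_graph :: "'a set \<Rightarrow> 'a set set \<Rightarrow> bool" where
  "simple_graph V E \<longleftrightarrow> finite V \<and> (\<forall>e\<in>E. e \<subseteq> V \<and> card e = 2)"

definition incident_edges :: "'a set set \<Rightarrow> 'a \<Rightarrow> 'a set set" where
  "incident_edges E v = {e \<in> E. v \<in> e}"

definition regular_graph :: "'a set \<Rightarrow> 'a set set \<Rightarrow> nat \<Rightarrow> bool" where
  "regular_graph V E d \<longleftrightarrow> simple_graph V E \<and> (\<forall>v\<in>V. card (incident_edges E v) = d)"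

definition proper_edge_coloring :: "'a set set \<Rightarrow> ('a set \<Rightarrow> nat) \<Rightarrow> bool" where
  "proper_edge_coloring E h \<longleftrightarrow>
     (\<forall>e\<in>E. \<forall>f\<in>E. e \<noteq> f \<and> e \<inter> f \<noteq> {} \<longrightarrow> h e \<noteq> h f)"

definition proper_d_edge_coloring :: "'a set set \<Rightarrow> nat \<Rightarrow> ('a set \<Rightarrow> nat) \<Rightarrow> bool" where
  "proper_d_edge_coloring E d h \<longleftrightarrow> proper_edge_coloring E h \<and> h ` E \<subseteq> {1..d}"

text \<open>Cycles are subgraphs, represented by their edge sets (so rotations and reflections of
  a cyclic vertex sequence are not counted separately).\<close>

definition four_cycle :: "'a set set \<Rightarrow> 'a set set \<Rightarrow> bool" where
  "four_cycle E C \<longleftrightarrow>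
     C \<subseteq> E \<and> (\<exists>u v w x. distinct [u, v, w, x] \<and> C = {{u, v}, {v, w}, {w, x}, {x, u}})"

definition two_colored :: "('a set \<Rightarrow> nat) \<Rightarrow> 'a set set \<Rightarrow> bool" where
  "two_colored h C \<longleftrightarrow> proper_edge_coloring C h \<and> card (h ` C) = 2"

definition standard_coloring :: "'a set set \<Rightarrow> nat \<Rightarrow> nat \<Rightarrow> ('a set \<Rightarrow> nat) \<Rightarrow> bool" where
  "standard_coloring E d s h \<longleftrightarrow>
     proper_d_edge_coloring E d h \<and>
     (\<forall>e\<in>E. card {C. four_cycle E C \<and> two_colored h C \<and> e \<in> C} \<ge> s - 1)"

definition ds_edge_colorable :: "'a set \<Rightarrow> 'a set set \<Rightarrow> nat \<Rightarrow> nat \<Rightarrow> bool" where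
  "ds_edge_colorable V E d s \<longleftrightarrow> regular_graph V E d \<and> (\<exists>h. standard_coloring E d s h)"

definition standard_matching :: "'a set set \<Rightarrow> nat \<Rightarrow> ('a set \<Rightarrow> nat) \<Rightarrow> 'a set set \<Rightarrow> bool" where
  "standard_matching E d h M \<longleftrightarrow> (\<exists>i\<in>{1..d}. M = {e \<in> E. h e = i})"

definition is_path :: "'a set set \<Rightarrow> 'a list \<Rightarrow> bool" where
  "is_path E p \<longleftrightarrow>
     p \<noteq> [] \<and> distinct p \<and> (\<forall>i. Suc i < length p \<longrightarrow> {p ! i, p ! Suc i} \<in> E)"

text \<open>The distance is \<open>\<infinity>\<close> for edges in different components.\<close>

definition edge_dist :: "'a set set \<Rightarrow> 'a set \<Rightarrow> 'a set \<Rightarrow> enat" where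
  "edge_dist E e f =
     Inf {enat (length p - 1) | p. is_path E p \<and> hd p \<in> e \<and> last p \<in> f}"

text \<open>The \<open>t\<close>-neighborhood is an edge-induced subgraph, so it is represented by its edge set.\<close>

definition edge_neighborhood :: "'a set set \<Rightarrow> nat \<Rightarrow> 'a set \<Rightarrow> 'a set set" where
  "edge_neighborhood E t e = {f \<in> E. edge_dist E e f \<le> enat t}"

definition list_assignment :: "'a set set \<Rightarrow> nat \<Rightarrow> ('a set \<Rightarrow> nat set) \<Rightarrow> bool" where
  "list_assignment E d L \<longleftrightarrow> (\<forall>e\<in>E. L e \<subseteq> {1..d})"

definition sparse_assignment ::
  "'a set \<Rightarrow> 'a set set \<Rightarrow> nat \<Rightarrow> nat \<Rightarrow> ('a set \<Rightarrow> nat) \<Rightarrow> real \<Rightarrow> ('a set \<Rightarrow> nat set) \<Rightarrow> bool" where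
  "sparse_assignment V E d s h \<beta> L \<longleftrightarrow>
     (\<forall>e\<in>E. real (card (L e)) \<le> \<beta> * real s) \<and>
     (\<forall>v\<in>V. \<forall>i\<in>{1..d}. real (card {e \<in> incident_edges E v. i \<in> L e}) \<le> \<beta> * real s) \<and>
     (\<forall>e\<in>E. \<forall>M. standard_matching E d h M \<longrightarrow>
        (\<forall>i\<in>{1..d}. real (card {f \<in> M \<inter> edge_neighborhood E 6 e. i \<in> L f}) \<le> \<beta> * real s))"

definition avoidable :: "'a set set \<Rightarrow> nat \<Rightarrow> ('a set \<Rightarrow> nat set) \<Rightarrow> bool" where
  "avoidable E d L \<longleftrightarrow>
     (\<exists>\<phi>. proper_d_edge_coloring E d \<phi> \<and> (\<forall>e\<in>E. \<phi> e \<notin> L e))"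

end

theory Submission
  imports Defs "HOL-Combinatorics.Permutations" "HOL-Library.FuncSet"
begin

text \<open>
  Permute the colors of \<open>h\<close> by a random permutation \<open>\<rho>\<close>.  With \<open>k = \<lfloor>c\<rfloor>\<close> and
  \<open>m = \<lfloor>s/16\<rfloor>\<close>, a union bound with failure probability \<open>k\<^sup>m/m!\<close> per event shows that some \<open>\<rho>\<close>
  creates fewer than \<open>m\<close> conflicts (edges colored from their own list) at each vertex, while for
  each edge \<open>e\<close> fewer than \<open>m\<close> of the 2-colored 4-cycles through \<open>e\<close> would become bad at the edge
  opposite to \<open>e\<close> when their two colors are exchanged.  Sparsity on standard matchings leaves at
  most \<open>k d\<close> conflicts in each 6-neighborhood, whatever \<open>\<rho>\<close> is.

  Conflicts are then removed greedily, by exchanging the colors on pairwise edge-disjoint 2-colored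
  4-cycles, one through each remaining conflict.  So that later conflicts still find free cycles,
  a new cycle must not use a vertex, or locally a second color, that \<open>m\<close> earlier cycles already
  use.  Double counting the nearby conflicts shows that this excludes at most \<open>5 k d / m\<close>
  cycles, and altogether at most \<open>7 k + 13 m + 5 k d / m < s - 1\<close> cycles are excluded.
\<close>

section \<open>Random permutations\<close>

text \<open>Fix one solution \<open>q\<close>, if there is any. Composing every solution with
  \<open>inv q\<close> yields permutations that fix \<open>T\<close> pointwise, that is,
  permutations of \<open>S - T\<close>.\<close>

lemma card_permutations_prescribed:
  assumes "finite S" "T \<subseteq> S"
  shows "card {p. p permutes S \<and> (\<forall>x\<in>T. p x = g x)} \<le> fact (card S - card T)"
proof (cases "\<exists>q. q permutes S \<and> (\<forall>x\<in>T. q x = g x)")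
  case True
  then obtain q where q: "q permutes S" "\<forall>x\<in>T. q x = g x" by blast
  let ?P = "{p. p permutes S \<and> (\<forall>x\<in>T. p x = g x)}"
  have sub: "(\<lambda>p. inv q \<circ> p) ` ?P \<subseteq> {p. p permutes (S - T)}"
  proof safe
    fix p assume p: "p permutes S" "\<forall>x\<in>T. p x = g x"
    have "inv q \<circ> p permutes S"
      using p q by (simp add: permutes_compose permutes_inv)
    moreover have "(inv q \<circ> p) x = x" if "x \<in> S - (S - T)" for x
    proof -
      have "p x = q x" using that p q by auto
      then show ?thesis using permutes_inverses(2)[OF q(1)] by simp
    qed
    ultimately show "inv q \<circ> p permutes (S - T)"
      by (rule permutes_superset) blast
  qed
  have inj: "inj_on (\<lambda>p. inv q \<circ> p) ?P"
  proof (rule inj_onI)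
    fix p p' assume "inv q \<circ> p = inv q \<circ> p'"
    then have "q \<circ> (inv q \<circ> p) = q \<circ> (inv q \<circ> p')" by simp
    then show "p = p'" using permutes_inv_o(1)[OF q(1)] by (simp add: o_assoc)
  qed
  have fin: "finite {p. p permutes (S - T)}"
    using assms by (simp add: finite_permutations)
  have "card ?P \<le> card {p. p permutes (S - T)}"
    using card_inj_on_le[OF inj sub fin] .
  also have "\<dots> = fact (card S - card T)"
    using assms by (simp add: card_permutations card_Diff_subset finite_subset)
  finally show ?thesis .
next
  case False
  then have "{p. p permutes S \<and> (\<forall>x\<in>T. p x = g x)} = {}" by blast
  then show ?thesis by (simp only: card.empty)
qed

text \<open>Union bound over the \<open>m\<close>-subsets \<open>T\<close> of \<open>S\<close> and
  the functions in \<open>PiE T A\<close>: at most \<open>(card S choose m) * k ^ m\<close>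
  prescriptions, each met by at most \<open>fact (card S - m)\<close> permutations. Multiplying by
  \<open>fact m\<close> avoids division.\<close>

lemma card_permutations_many_hits:
  fixes A :: "'b \<Rightarrow> 'b set"
  assumes S: "finite S" and A: "\<And>x. x \<in> S \<Longrightarrow> finite (A x) \<and> card (A x) \<le> k"
  shows "card {p. p permutes S \<and> m \<le> card {x\<in>S. p x \<in> A x}} * fact m \<le> fact (card S) * k ^ m"
    (is "card ?B * _ \<le> _")
proof (cases "m \<le> card S")
  case True
  let ?F = "\<lambda>T g. {p. p permutes S \<and> (\<forall>x\<in>T. p x = g x)}"
  let ?TT = "{T. T \<subseteq> S \<and> card T = m}"
  have finT: "finite ?TT" using S by simp
  have finP: "finite (PiE T A)" "card (PiE T A) \<le> k ^ m" if "T \<in> ?TT" for T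
  proof -
    have T: "finite T" using that S finite_subset by auto
    show "finite (PiE T A)" using that A T by (intro finite_PiE) auto
    have "card (PiE T A) = (\<Prod>x\<in>T. card (A x))" using T by (rule card_PiE)
    also have "\<dots> \<le> (\<Prod>x\<in>T. k)" using that A by (intro prod_mono) auto
    finally show "card (PiE T A) \<le> k ^ m" using that by simp
  qed
  have "?B \<subseteq> (\<Union>T\<in>?TT. \<Union>g\<in>PiE T A. ?F T g)"
  proof
    fix p assume "p \<in> ?B"
    then have p: "p permutes S" "m \<le> card {x\<in>S. p x \<in> A x}" by auto
    obtain T where T: "T \<subseteq> {x\<in>S. p x \<in> A x}" "card T = m"
      using obtain_subset_with_card_n[OF p(2)] by metis
    then have "restrict p T \<in> PiE T A" "p \<in> ?F T (restrict p T)" "T \<in> ?TT"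
      using p by auto
    then show "p \<in> (\<Union>T\<in>?TT. \<Union>g\<in>PiE T A. ?F T g)" by blast
  qed
  moreover have "finite (\<Union>T\<in>?TT. \<Union>g\<in>PiE T A. ?F T g)"
    by (rule finite_subset[OF _ finite_permutations[OF S]]) auto
  ultimately have "card ?B \<le> card (\<Union>T\<in>?TT. \<Union>g\<in>PiE T A. ?F T g)"
    by (simp add: card_mono)
  also have "\<dots> \<le> (\<Sum>T\<in>?TT. card (\<Union>g\<in>PiE T A. ?F T g))"
    by (rule card_UN_le[OF finT])
  also have "\<dots> \<le> (\<Sum>T\<in>?TT. k ^ m * fact (card S - m))"
  proof (rule sum_mono)
    fix T assume T: "T \<in> ?TT"
    have "card (\<Union>g\<in>PiE T A. ?F T g) \<le> (\<Sum>g\<in>PiE T A. card (?F T g))"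
      by (rule card_UN_le[OF finP(1)[OF T]])
    also have "\<dots> \<le> (\<Sum>g\<in>PiE T A. fact (card S - m))"
      using T card_permutations_prescribed[OF S] by (intro sum_mono) auto
    also have "\<dots> \<le> k ^ m * fact (card S - m)"
      using finP(2)[OF T] by simp
    finally show "card (\<Union>g\<in>PiE T A. ?F T g) \<le> k ^ m * fact (card S - m)" .
  qed
  also have "\<dots> = (card S choose m) * (k ^ m * fact (card S - m))"
    using n_subsets[OF S] by simp
  finally have "card ?B * fact m \<le> (fact m * fact (card S - m) * (card S choose m)) * k ^ m"
    by (simp add: algebra_simps)
  also have "\<dots> = fact (card S) * k ^ m"
    using binomial_fact_lemma[OF True] by simp
  finally show ?thesis .
next
  case False
  have "card {x\<in>S. p x \<in> A x} \<le> card S" for p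
    using S by (intro card_mono) auto
  then have "?B = {}" using False le_trans by blast
  then show ?thesis by (simp only: card.empty)
qed

lemma exists_permutation_few_hits:
  fixes A :: "'i \<Rightarrow> 'b \<Rightarrow> 'b set"
  assumes S: "finite S" and I: "finite I"
    and A: "\<And>i x. i \<in> I \<Longrightarrow> x \<in> S \<Longrightarrow> finite (A i x) \<and> card (A i x) \<le> k"
    and less: "card I * k ^ m < fact m"
  obtains p where "p permutes S" "\<And>i. i \<in> I \<Longrightarrow> card {x\<in>S. p x \<in> A i x} < m"
proof -
  let ?B = "\<lambda>i. {p. p permutes S \<and> m \<le> card {x\<in>S. p x \<in> A i x}}"
  have "card (\<Union>i\<in>I. ?B i) * fact m \<le> (\<Sum>i\<in>I. card (?B i)) * fact m"
    using card_UN_le[OF I] by simp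
  also have "\<dots> = (\<Sum>i\<in>I. card (?B i) * fact m)" by (rule sum_distrib_right)
  also have "\<dots> \<le> (\<Sum>i\<in>I. fact (card S) * k ^ m)"
    using A by (intro sum_mono card_permutations_many_hits[OF S]) auto
  also have "\<dots> = fact (card S) * (card I * k ^ m)" by simp
  also have "\<dots> < fact (card S) * fact m" using less by simp
  finally have less: "card (\<Union>i\<in>I. ?B i) < card {p. p permutes S}"
    using S by (simp add: card_permutations)
  have fin: "finite (\<Union>i\<in>I. ?B i)"
    by (rule finite_subset[OF _ finite_permutations[OF S]]) auto
  have "\<not> {p. p permutes S} \<subseteq> (\<Union>i\<in>I. ?B i)"
    using card_mono[OF fin, of "{p. p permutes S}"] less by linarith
  then obtain p where "p \<in> {p. p permutes S}" "p \<notin> (\<Union>i\<in>I. ?B i)"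
    by (meson subsetI)
  then show thesis using that[of p] by (auto simp: not_le)
qed

section \<open>Numerical consequences of the size hypothesis\<close>

lemma power_self_le_fact: "real m ^ m \<le> 3 ^ m * fact m"
proof (induction m)
  case (Suc m)
  \<comment> \<open>Each induction step costs one factor 3, because (1 + 1/m)^m <= e <= 3.\<close>
  have "real (Suc m) ^ m \<le> 3 * real m ^ m"
  proof (cases "m = 0")
    case False
    have "real (Suc m) ^ m = (1 + 1 / real m) ^ m * real m ^ m"
      using False by (simp add: power_mult_distrib[symmetric] field_simps)
    also have "(1 + 1 / real m) ^ m \<le> exp (1 / real m) ^ m"
      by (intro power_mono exp_ge_add_one_self) auto
    also have "exp (1 / real m) ^ m = exp 1" using False by (simp add: exp_of_nat_mult[symmetric])
    also have "exp 1 \<le> (3::real)" by (rule exp_le)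
    finally show ?thesis by (simp add: mult_right_mono)
  qed simp
  then have "real (Suc m) ^ Suc m \<le> real (Suc m) * (3 * real m ^ m)"
    by (simp add: mult_left_mono del: of_nat_Suc)
  also have "\<dots> \<le> real (Suc m) * (3 * (3 ^ m * fact m))"
    using Suc by (intro mult_left_mono) auto
  finally show ?case by (simp add: algebra_simps)
qed simp

text \<open>The first bound serves the union bound over at most \<open>n ^ 2\<close> events. The
  second, read after division by \<open>m\<close>, says that fewer cycles are excluded at an edge
  than the \<open>s - 1\<close> available ones.\<close>

lemma parameter_bounds:
  fixes d s n k m :: nat and c :: real
  assumes n: "2 \<le> n" and c: "1 \<le> c" and d: "0 < d" "s \<le> d"
    and large: "1 / 2 * (2 powi (-11) * inverse c * real s ^ 2 * inverse (real d))
        powr (2 powi (-9) * inverse (real d) * real s ^ 2) \<ge> real n"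
    and k: "k = nat \<lfloor>c\<rfloor>" and m: "m = s div 16"
  shows "n ^ 2 * k ^ m < fact m" and "m * (7 * k + 13 * m) + 5 * (k * d) < m * (s - 1)"
proof -
  define X where "X = real s ^ 2 / (2048 * c * real d)"
  define p where "p = real s ^ 2 / (512 * real d)"
  have "2 powi (-11) * inverse c * real s ^ 2 * inverse (real d) = X"
    "2 powi (-9) * inverse (real d) * real s ^ 2 = p"
    by (simp_all add: X_def p_def power_int_minus field_simps)
  then have nX: "2 * real n \<le> X powr p" using large by simp
  have X0: "0 \<le> X" and p0: "0 \<le> p" using c by (simp_all add: X_def p_def)
  \<comment> \<open>Otherwise X powr p <= 1 < 2 n. Unfolded, \<open>X1\<close> reads s^2 > 2048 c d,
    and \<open>s \<le> d\<close> then gives s > 2048 c.\<close>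
  have X1: "1 < X"
  proof (rule ccontr)
    assume "\<not> 1 < X"
    then have "X powr p \<le> 1" using X0 p0 by (intro powr_le1) auto
    then show False using nX n by simp
  qed
  have kc: "real k \<le> c" "1 \<le> k" using of_nat_floor[of c] le_nat_floor[of 1 c] c by (simp_all add: k)
  have ssq: "2048 * c * real d < real s ^ 2" using X1 c d by (simp add: X_def field_simps)
  have sd: "real s ^ 2 \<le> real s * real d" using d by (simp add: power2_eq_square mult_left_mono)
  have "2048 * c * real d < real s * real d" using ssq sd by simp
  then have sc: "2048 * c < real s" using d by simp
  then have s2048: "2048 < s" using c by simp
  \<comment> \<open>The divisor 16 keeps 13 m well below s. As s > 2048, the remainder is less than
    m, whence s <= 17 m.\<close>
  have "s = 16 * m + s mod 16" "s mod 16 < 16" by (simp_all add: m)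
  then have m16: "16 * m \<le> s" and m17: "s \<le> 17 * m" and m0: "0 < m" using s2048 by linarith+
  have m16': "16 * real m \<le> real s" and m17': "real s \<le> 17 * real m"
    using m16 m17 by linarith+

  have "p \<le> real s / 512" using sd d by (simp add: p_def field_simps)
  then have pm: "2 * p \<le> real m" using m17' by simp
  have "X \<le> real s / (2048 * c)" using sd d c by (simp add: X_def field_simps)
  also have "\<dots> \<le> 17 * real m / (2048 * real k)"
    using m17' kc by (intro frac_le) auto
  also have "\<dots> \<le> real m / (3 * real k)" using kc by (simp add: field_simps)
  finally have Xm: "X \<le> real m / (3 * real k)" .
  \<comment> \<open>Squaring produces the number \<open>n ^ 2\<close> of events. The exponent
    \<open>2 * p\<close> is at most \<open>m\<close> and the base at most m / (3 k), which fits
    \<open>power_self_le_fact\<close>; the spare factor 4 gives strictness.\<close>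
  have "(2 * real n) ^ 2 \<le> (X powr p) ^ 2" using nX by (intro power_mono) auto
  also have "\<dots> = X powr (2 * p)" using X1 by (simp add: power2_eq_square powr_add[symmetric])
  also have "\<dots> \<le> X powr real m" using pm X1 by (intro powr_mono) auto
  also have "\<dots> = X ^ m" using X1 by (intro powr_realpow) auto
  also have "\<dots> \<le> (real m / (3 * real k)) ^ m" using Xm X0 by (intro power_mono)
  finally have "(2 * real n) ^ 2 * real k ^ m \<le> (real m / (3 * real k)) ^ m * real k ^ m"
    by (intro mult_right_mono) auto
  also have "\<dots> = real m ^ m / 3 ^ m" using kc by (simp add: power_divide power_mult_distrib)
  also have "\<dots> \<le> fact m" using power_self_le_fact[of m] by (simp add: field_simps)
  finally have four: "4 * (real n ^ 2 * real k ^ m) \<le> fact m" by (simp add: power_mult_distrib)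
  have "0 < real n ^ 2 * real k ^ m" using n kc by simp
  with four have "real n ^ 2 * real k ^ m < fact m" by linarith
  then have "real (n ^ 2 * k ^ m) < real (fact m)" by simp
  then show "n ^ 2 * k ^ m < fact m" by (simp only: of_nat_less_iff)

  \<comment> \<open>Relative to m s, the three terms are at most 7/2048, 13/16 and 85/2048, together
    below 0.86. The slack exceeds m because s > 2048.\<close>
  have "2048 * real k \<le> real s" using sc kc by simp
  then have "real m * (2048 * (7 * real k)) \<le> real m * (7 * real s)" by (intro mult_left_mono) auto
  moreover have "real m * (13 * 16 * real m) \<le> real m * (13 * real s)"
    using m16' by (intro mult_left_mono) auto
  moreover have "2048 * (real k * real d) \<le> 17 * (real m * real s)"
  proof -
    have "2048 * real k * real d \<le> 2048 * c * real d" using kc by (intro mult_right_mono) auto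
    also have "\<dots> \<le> real s * real s" using ssq by (simp add: power2_eq_square)
    also have "\<dots> \<le> (17 * real m) * real s" using m17' by (intro mult_right_mono) auto
    finally show ?thesis by simp
  qed
  moreover have "real m * 2048 < real m * real s" using s2048 m0 by simp
  ultimately have "real m * (7 * real k) + real m * (13 * real m) + 5 * (real k * real d)
      < real m * real s - real m"
    by linarith
  also have "\<dots> = real (m * (s - 1))" using s2048 by (simp add: of_nat_diff algebra_simps)
  finally have "real (m * (7 * k + 13 * m) + 5 * (k * d)) < real (m * (s - 1))"
    by (simp add: algebra_simps)
  then show "m * (7 * k + 13 * m) + 5 * (k * d) < m * (s - 1)" by (simp only: of_nat_less_iff)
qed

section \<open>2-colored 4-cycles\<close>

lemma is_path_snoc:
  assumes p: "is_path E p" and e: "{last p, w} \<in> E"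
  obtains q where "is_path E q" "hd q = hd p" "last q = w" "length q \<le> Suc (length p)"
proof (cases "w \<in> set p")
  case True
  \<comment> \<open>If \<open>w\<close> already lies on the path, cutting the path there keeps its
    vertices distinct.\<close>
  then obtain xs ys where xs: "p = xs @ w # ys" by (auto simp: in_set_conv_decomp)
  have "is_path E (xs @ [w])"
    unfolding is_path_def
  proof (intro conjI allI impI)
    show "distinct (xs @ [w])" using p xs by (auto simp: is_path_def)
    fix i assume i: "Suc i < length (xs @ [w])"
    then have "{p ! i, p ! Suc i} \<in> E" using p xs by (auto simp: is_path_def)
    moreover have "p ! j = (xs @ [w]) ! j" if "j \<le> length xs" for j
      using that xs by (auto simp: nth_append)
    ultimately show "{(xs @ [w]) ! i, (xs @ [w]) ! Suc i} \<in> E" using i by simp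
  qed simp
  moreover have "hd (xs @ [w]) = hd p" using xs by (cases xs) auto
  ultimately show thesis using that[of "xs @ [w]"] xs by simp
next
  case False
  have ne: "p \<noteq> []" using p by (simp add: is_path_def)
  have "is_path E (p @ [w])"
    unfolding is_path_def
  proof (intro conjI allI impI)
    show "distinct (p @ [w])" using p False by (auto simp: is_path_def)
    fix i assume i: "Suc i < length (p @ [w])"
    show "{(p @ [w]) ! i, (p @ [w]) ! Suc i} \<in> E"
    proof (cases "Suc i < length p")
      case True
      then show ?thesis using p by (auto simp: is_path_def nth_append)
    next
      case False
      then have "i = length p - 1" using i by auto
      then show ?thesis using e ne by (auto simp: nth_append last_conv_nth)
    qed
  qed simp
  then show thesis using that[of "p @ [w]"] ne by simp
qed

text \<open>Equality belongs to the relation, so idle steps are allowed and \<open>^^ t\<close>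
  covers all walks of at most \<open>t\<close> edges.\<close>

lemma walk_imp_path:
  assumes "(a, b) \<in> {(x, y). x = y \<or> {x, y} \<in> E} ^^ t"
  shows "\<exists>p. is_path E p \<and> hd p = a \<and> last p = b \<and> length p \<le> Suc t"
  using assms
proof (induction t arbitrary: b)
  case 0
  then have "is_path E [a] \<and> hd [a] = a \<and> last [a] = b" by (simp add: is_path_def)
  then show ?case by fastforce
next
  case (Suc t)
  then obtain y where y: "(a, y) \<in> {(x, y). x = y \<or> {x, y} \<in> E} ^^ t" "y = b \<or> {y, b} \<in> E"
    by auto
  obtain p where p: "is_path E p" "hd p = a" "last p = y" "length p \<le> Suc t"
    using Suc.IH[OF y(1)] by blast
  show ?case
  proof (cases "y = b")
    case True
    then show ?thesis using p by (intro exI[of _ p]) auto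
  next
    case False
    then have "{last p, b} \<in> E" using p y by simp
    then obtain q where "is_path E q" "hd q = hd p" "last q = b" "length q \<le> Suc (length p)"
      using is_path_snoc[OF p(1)] by blast
    then show ?thesis using p by (intro exI[of _ q]) auto
  qed
qed

text \<open>All closeness claims below join two edges by a chain of at most three edges; the
  disjunctions let any step be idle.\<close>

lemma edge_neighborhoodI:
  assumes "f \<in> E" "a \<in> e" "b \<in> f"
    and "a = x \<or> {a, x} \<in> E" "x = y \<or> {x, y} \<in> E" "y = b \<or> {y, b} \<in> E" and "3 \<le> t"
  shows "f \<in> edge_neighborhood E t e"
proof -
  let ?R = "{(x, y). x = y \<or> {x, y} \<in> E}"
  have steps: "(a, x) \<in> ?R" "(x, y) \<in> ?R" "(y, b) \<in> ?R" using assms(4-6) by simp_all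
  have "(a, b) \<in> ?R ^^ Suc (Suc (Suc 0))"
    by (rule relpow_Suc_I[OF relpow_Suc_I[OF relpow_Suc_I[OF relpow_0_I]]]) (fact steps)+
  then obtain p where p: "is_path E p" "hd p = a" "last p = b" "length p \<le> 4"
    using walk_imp_path[where t = "Suc (Suc (Suc 0))" and a = a and b = b and E = E] by (auto simp del: relpow.simps)
  have "edge_dist E e f \<le> enat (length p - 1)"
    unfolding edge_dist_def 
    by (rule Inf_lower) (use p assms(2,3) in \<open>auto intro!: exI[of _ p]\<close>)
  also have "\<dots> \<le> enat t" using p assms by simp
  finally show ?thesis using assms by (simp add: edge_neighborhood_def)
qed

section \<open>Color classes as perfect matchings, and coordinates for 2-colored 4-cycles\<close>

locale factorized_graph =
  fixes V :: "'a set" and E :: "'a set set" and d :: nat and h :: "'a set \<Rightarrow> nat"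
  assumes regular: "regular_graph V E d" and proper: "proper_d_edge_coloring E d h"
begin

text \<open>Each color class is a perfect matching, and \<open>nb j\<close> is the involution
  exchanging the ends of its edges; it is meaningful for \<open>v \<in> V\<close> and
  \<open>j \<in> {1..d}\<close>.\<close>

definition nb :: "nat \<Rightarrow> 'a \<Rightarrow> 'a" where
  "nb j v = (THE w. {v, w} \<in> E \<and> h {v, w} = j)"

text \<open>A 2-colored 4-cycle through \<open>e\<close> is determined by its second color
  \<open>j\<close>, since its edge opposite to \<open>e\<close> is the image of \<open>e\<close>
  under \<open>nb j\<close>. These are the second colors that occur; \<open>cyc\<close> rebuilds the
  cycle.\<close>

definition opp_colors :: "'a set \<Rightarrow> nat set" where
  "opp_colors e = {j \<in> {1..d}. j \<noteq> h e \<and> nb j ` e \<in> E \<and> h (nb j ` e) = h e}"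

definition cyc :: "'a set \<Rightarrow> nat \<Rightarrow> 'a set set" where
  "cyc e j = {e, nb j ` e} \<union> (\<lambda>v. {v, nb j v}) ` e"

lemma finite_V: "finite V" and edge_subset: "e \<in> E \<Longrightarrow> e \<subseteq> V" and edge_card: "e \<in> E \<Longrightarrow> card e = 2"
  using regular by (auto simp: regular_graph_def simple_graph_def)

lemma finite_E: "finite E"
  by (rule finite_subset[of _ "Pow V"]) (use finite_V edge_subset in auto)

lemma card_E: "2 * card E \<le> card V * (card V - 1)"
proof -
  have "card E \<le> card {e. e \<subseteq> V \<and> card e = 2}"
    using finite_V edge_subset edge_card by (intro card_mono) auto
  also have "\<dots> = card V choose 2" using finite_V by (rule n_subsets)
  finally show ?thesis by (simp add: choose_two)
qed

lemma color_range: "e \<in> E \<Longrightarrow> h e \<in> {1..d}"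
  using proper by (auto simp: proper_d_edge_coloring_def)

lemma edge_eqI:
  assumes "e \<in> E" "f \<in> E" "v \<in> e" "v \<in> f" "h e = h f"
  shows "e = f"
  using proper assms unfolding proper_d_edge_coloring_def proper_edge_coloring_def by blast

text \<open>The \<open>d\<close> edges at \<open>v\<close> have distinct colors among
  \<open>d\<close> colors, so none is missing.\<close>

lemma ex_edge_color:
  assumes "v \<in> V" "j \<in> {1..d}"
  shows "\<exists>e\<in>E. v \<in> e \<and> h e = j"
proof -
  have "inj_on h (incident_edges E v)"
    unfolding incident_edges_def using edge_eqI[of _ _ v] by (intro inj_onI) blast
  then have "card (h ` incident_edges E v) = d"
    using assms regular by (simp add: card_image regular_graph_def)
  moreover have "h ` incident_edges E v \<subseteq> {1..d}"
    using color_range by (auto simp: incident_edges_def)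
  ultimately have "h ` incident_edges E v = {1..d}"
    using card_subset_eq[of "{1..d}" "h ` incident_edges E v"] by simp
  with assms(2) have "j \<in> h ` incident_edges E v" by simp
  then show ?thesis by (auto simp: incident_edges_def)
qed

lemma edge_other:
  assumes "e \<in> E" "v \<in> e"
  obtains w where "e = {v, w}" "w \<noteq> v"
proof -
  obtain x y where "e = {x, y}" "x \<noteq> y" using edge_card[OF assms(1)] by (auto simp: card_2_iff)
  then show thesis using that assms(2) by (cases "v = x") (auto simp: insert_commute)
qed

lemma nb_unique:
  assumes "{v, w} \<in> E"
  shows "nb (h {v, w}) v = w"
  unfolding nb_def
proof (rule the_equality)
  fix w' assume w': "{v, w'} \<in> E \<and> h {v, w'} = h {v, w}"
  then have "{v, w'} = {v, w}" using assms by (intro edge_eqI[where v = v]) auto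
  then show "w' = w" by (auto simp: doubleton_eq_iff)
qed (use assms in simp)

lemma nb_edge:
  assumes "v \<in> V" "j \<in> {1..d}"
  shows "{v, nb j v} \<in> E" "h {v, nb j v} = j" "nb j v \<in> V" "nb j v \<noteq> v"
proof -
  obtain e where e: "e \<in> E" "v \<in> e" "h e = j" using ex_edge_color[OF assms] by blast
  obtain w where w: "e = {v, w}" "w \<noteq> v" using edge_other e by blast
  have "nb j v = w" using nb_unique[of v w] e w by simp
  then show "{v, nb j v} \<in> E" "h {v, nb j v} = j" "nb j v \<in> V" "nb j v \<noteq> v"
    using e w edge_subset[of e] by simp_all
qed

lemma edge_eq_nb: "e \<in> E \<Longrightarrow> v \<in> e \<Longrightarrow> e = {v, nb (h e) v}"
  using nb_unique edge_other by metis

lemma nb_nb: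
  assumes "v \<in> V" "j \<in> {1..d}"
  shows "nb j (nb j v) = v"
  using nb_unique[of "nb j v" v] nb_edge[OF assms] by (simp add: insert_commute)

lemma edge_vertex: "e \<in> E \<Longrightarrow> v \<in> e \<Longrightarrow> v \<in> V"
  using edge_subset by blast

lemma opp_colorsD:
  assumes "j \<in> opp_colors e"
  shows "j \<in> {1..d}" "j \<noteq> h e" "nb j ` e \<in> E" "h (nb j ` e) = h e"
  using assms by (auto simp: opp_colors_def)

lemma finite_opp_colors: "finite (opp_colors e)"
  by (simp add: opp_colors_def)

lemma cyc_color:
  assumes "e \<in> E" "j \<in> opp_colors e" "f \<in> cyc e j"
  shows "h f = h e \<and> f \<in> {e, nb j ` e} \<or> h f = j \<and> (\<exists>v\<in>e. f = {v, nb j v})"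
  using assms(3) opp_colorsD(1,4)[OF assms(2)] nb_edge(2)[of _ j] edge_vertex[OF assms(1)]
  by (auto simp: cyc_def)

text \<open>At each of its vertices a cycle contains the edges of both its colors, so exchanging
  these colors never leads out of the cycle. \<open>switch_disjoint_cycles\<close> rests on
  this.\<close>

lemma cyc_at_vertex:
  assumes e: "e \<in> E" and j: "j \<in> opp_colors e" and f: "f \<in> cyc e j" "v \<in> f"
  shows "v \<in> e \<union> nb j ` e" "{v, nb (h e) v} \<in> cyc e j" "{v, nb j v} \<in> cyc e j"
proof -
  show v: "v \<in> e \<union> nb j ` e" using f by (auto simp: cyc_def)
  show "{v, nb (h e) v} \<in> cyc e j"
    using v edge_eq_nb[OF e, of v] edge_eq_nb[of "nb j ` e" v] opp_colorsD[OF j]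
    by (auto simp: cyc_def)
  from v consider "v \<in> e" | u where "u \<in> e" "v = nb j u" by blast
  then show "{v, nb j v} \<in> cyc e j"
  proof cases
    case 2
    then have "{v, nb j v} = {u, nb j u}"
      using nb_nb[of u j] edge_vertex[OF e] opp_colorsD[OF j] by auto
    then show ?thesis using 2 by (simp add: cyc_def)
  qed (simp add: cyc_def)
qed

text \<open>Adjacent edges differ in color, so having only two colors forces opposite edges to
  agree; \<open>h {v, w}\<close> is the second color.\<close>

lemma four_cycle_eq_cyc:
  assumes C: "C = {{u, v}, {v, w}, {w, x}, {x, u}}" "C \<subseteq> E"
    and dist: "distinct [u, v, w, x]" and two: "card (h ` C) = 2"
  shows "C \<in> cyc {u, v} ` opp_colors {u, v}"
proof -
  have E: "{u, v} \<in> E" "{v, w} \<in> E" "{w, x} \<in> E" "{x, u} \<in> E" using C by auto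
  have neq: "h {u, v} \<noteq> h {v, w}" "h {v, w} \<noteq> h {w, x}" "h {w, x} \<noteq> h {x, u}" "h {x, u} \<noteq> h {u, v}"
    using edge_eqI[of "{u, v}" "{v, w}" v] edge_eqI[of "{v, w}" "{w, x}" w]
      edge_eqI[of "{w, x}" "{x, u}" x] edge_eqI[of "{x, u}" "{u, v}" u] E dist
    by (auto simp: doubleton_eq_iff)
  have "h ` C = {h {u, v}, h {v, w}, h {w, x}, h {x, u}}" using C by auto
  then obtain a b where "{h {u, v}, h {v, w}, h {w, x}, h {x, u}} = {a, b}"
    using two by (auto simp: card_2_iff)
  then have "h {u, v} \<in> {a, b}" "h {v, w} \<in> {a, b}" "h {w, x} \<in> {a, b}" "h {x, u} \<in> {a, b}"
    by blast+
  then have eq: "h {w, x} = h {u, v}" "h {x, u} = h {v, w}" using neq by auto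
  have nb: "nb (h {v, w}) v = w" "nb (h {v, w}) u = x"
    using nb_unique[OF E(2)] nb_unique[of u x] E eq by (simp_all add: insert_commute)
  then have "nb (h {v, w}) ` {u, v} = {w, x}" by auto
  then have "h {v, w} \<in> opp_colors {u, v}" "cyc {u, v} (h {v, w}) = C"
    using E eq neq nb C color_range by (auto simp: opp_colors_def cyc_def insert_commute)
  then show ?thesis by blast
qed

text \<open>Converts the supply of 2-colored 4-cycles through \<open>e\<close> into a supply of
  second colors, among which the greedy choice is made.\<close>

lemma card_opp_colors:
  "card {C. four_cycle E C \<and> two_colored h C \<and> e \<in> C} \<le> card (opp_colors e)"
proof -
  have "C \<in> cyc e ` opp_colors e" if "four_cycle E C" "two_colored h C" "e \<in> C" for C
  proof -
    obtain u v w x where C: "C \<subseteq> E" "distinct [u, v, w, x]" "C = {{u, v}, {v, w}, {w, x}, {x, u}}"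
      using \<open>four_cycle E C\<close> by (auto simp: four_cycle_def)
    have two: "card (h ` C) = 2" using that by (simp add: two_colored_def)
    \<comment> \<open>\<open>e\<close> may be any edge of the cycle; rotating the vertex sequence
      makes it the first.\<close>
    from C(3) \<open>e \<in> C\<close> consider "e = {u, v}" | "e = {v, w}" | "e = {w, x}" | "e = {x, u}" by blast
    then show ?thesis
    proof cases
      case 1
      then show ?thesis using four_cycle_eq_cyc[of C u v w x] C two by simp
    next
      case 2
      moreover have "C = {{v, w}, {w, x}, {x, u}, {u, v}}" using C(3) by blast
      ultimately show ?thesis using four_cycle_eq_cyc[of C v w x u] C(1,2) two by auto
    next
      case 3
      moreover have "C = {{w, x}, {x, u}, {u, v}, {v, w}}" using C(3) by blast
      ultimately show ?thesis using four_cycle_eq_cyc[of C w x u v] C(1,2) two by auto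
    next
      case 4
      moreover have "C = {{x, u}, {u, v}, {v, w}, {w, x}}" using C(3) by blast
      ultimately show ?thesis using four_cycle_eq_cyc[of C x u v w] C(1,2) two by auto
    qed
  qed
  then have "card {C. four_cycle E C \<and> two_colored h C \<and> e \<in> C} \<le> card (cyc e ` opp_colors e)"
    by (intro card_mono finite_imageI finite_opp_colors) auto
  also have "\<dots> \<le> card (opp_colors e)" by (rule card_image_le[OF finite_opp_colors])
  finally show ?thesis .
qed

text \<open>At each vertex, switching the chosen cycles exchanges the incident edges in pairs.\<close>

lemma switch_disjoint_cycles:
  assumes D: "D \<subseteq> E" "\<And>e. e \<in> D \<Longrightarrow> g e \<in> opp_colors e"
    and disj: "\<And>e e'. e \<in> D \<Longrightarrow> e' \<in> D \<Longrightarrow> e \<noteq> e' \<Longrightarrow> cyc e (g e) \<inter> cyc e' (g e') = {}"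
  obtains \<sigma> where "proper_d_edge_coloring E d \<sigma>"
    and "\<And>f. f \<in> E \<Longrightarrow> f \<notin> (\<Union>e\<in>D. cyc e (g e)) \<Longrightarrow> \<sigma> f = h f"
    and "\<And>e f. e \<in> D \<Longrightarrow> f \<in> cyc e (g e) \<Longrightarrow> \<sigma> f = (if h f = h e then g e else h e)"
proof -
  \<comment> \<open>Disjointness makes the chosen cycle through \<open>f\<close> unique, so
    \<open>THE\<close> is well defined here.\<close>
  define \<sigma> where "\<sigma> f = (if \<exists>e\<in>D. f \<in> cyc e (g e)
    then let e = (THE e. e \<in> D \<and> f \<in> cyc e (g e)) in (if h f = h e then g e else h e)
    else h f)" for f
  have \<sigma>_out: "\<sigma> f = h f" if "f \<notin> (\<Union>e\<in>D. cyc e (g e))" for f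
    using that by (auto simp: \<sigma>_def)
  have \<sigma>_in: "\<sigma> f = (if h f = h e then g e else h e)" if "e \<in> D" "f \<in> cyc e (g e)" for e f
  proof -
    have "(THE e. e \<in> D \<and> f \<in> cyc e (g e)) = e" using that disj by (intro the_equality) blast+
    then show ?thesis using that unfolding \<sigma>_def Let_def by auto
  qed
  have \<sigma>_range: "\<sigma> f \<in> {1..d}" if "f \<in> E" for f
  proof (cases "\<exists>e\<in>D. f \<in> cyc e (g e)")
    case True
    then obtain e where e: "e \<in> D" "f \<in> cyc e (g e)" by blast
    then show ?thesis
      using \<sigma>_in[OF e] color_range[of e] opp_colorsD(1)[OF D(2)[OF e(1)]] D(1) by auto
  next
    case False
    then show ?thesis using \<sigma>_out color_range[OF that] by auto
  qed
  \<comment> \<open>For fixed \<open>v\<close>, sending \<open>f\<close> to the edge at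
    \<open>v\<close> of \<open>h\<close>-color \<open>\<sigma> f\<close> is an involution. Hence
    \<open>\<sigma>\<close> is injective on the edges at \<open>v\<close>.\<close>
  have invol: "{v, nb (\<sigma> {v, nb (\<sigma> f) v}) v} = f" if f: "f \<in> E" "v \<in> f" for f v
  proof (cases "\<exists>e\<in>D. f \<in> cyc e (g e)")
    case True
    then obtain e where e: "e \<in> D" "f \<in> cyc e (g e)" by blast
    have eE: "e \<in> E" and j: "g e \<in> opp_colors e" using D e by auto
    let ?f = "{v, nb (\<sigma> f) v}"
    have hf: "h f = h e \<or> h f = g e" using cyc_color[OF eE j e(2)] by blast
    have f': "?f \<in> cyc e (g e)"
      using cyc_at_vertex(2,3)[OF eE j e(2) f(2)] \<sigma>_in[OF e] by auto
    have "h ?f = \<sigma> f" using nb_edge(2)[of v "\<sigma> f"] f \<sigma>_range edge_vertex by blast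
    then have "\<sigma> ?f = h f"
      using \<sigma>_in[OF e(1) f'] \<sigma>_in[OF e] hf opp_colorsD(2)[OF j] by (auto split: if_splits)
    then show ?thesis using edge_eq_nb[OF f] by simp
  next
    case False
    then have "\<sigma> f = h f" using \<sigma>_out by blast
    then show ?thesis using edge_eq_nb[OF f] by simp
  qed
  have "\<sigma> e \<noteq> \<sigma> f" if "e \<in> E" "f \<in> E" "e \<noteq> f" "v \<in> e" "v \<in> f" for e f v
    using invol[of e v] invol[of f v] that by metis
  then have "proper_d_edge_coloring E d \<sigma>"
    using \<sigma>_range unfolding proper_d_edge_coloring_def proper_edge_coloring_def by blast
  then show thesis using that \<sigma>_out \<sigma>_in by blast
qed

end

section \<open>Greedy removal of conflicts\<close>

lemma double_count_le:
  assumes "finite J" "finite N"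
    and "\<And>j. j \<in> J \<Longrightarrow> m \<le> card {e\<in>N. R j e}" and "\<And>e. e \<in> N \<Longrightarrow> card {j\<in>J. R j e} \<le> r"
  shows "m * card J \<le> r * card N"
proof -
  have "m * card J = (\<Sum>j\<in>J. m)" by simp
  also have "\<dots> \<le> (\<Sum>j\<in>J. card {e\<in>N. R j e})" using assms(3) by (rule sum_mono)
  also have "\<dots> = (\<Sum>e\<in>N. card {j\<in>J. R j e})"
    using assms(1,2) by (intro sum_multicount_gen) auto
  also have "\<dots> \<le> (\<Sum>e\<in>N. r)" using assms(4) by (rule sum_mono)
  finally show ?thesis by (simp add: mult.commute)
qed

text \<open>The coloring to be repaired is \<open>\<rho> \<circ> h\<close>, but cycles and switches
  are described by colors of \<open>h\<close>, with \<open>\<rho>\<close> applied last.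
  \<open>many_cycles\<close> is the count of excluded cycles, multiplied by
  \<open>m\<close>.\<close>

locale sparse_conflicts = factorized_graph +
  fixes L :: "'a set \<Rightarrow> nat set" and \<rho> :: "nat \<Rightarrow> nat" and k m :: nat
  assumes perm: "\<rho> permutes {1..d}"
    and finite_L: "\<And>e. e \<in> E \<Longrightarrow> finite (L e)"
    and card_L: "\<And>e. e \<in> E \<Longrightarrow> card (L e) \<le> k"
    and card_L_vertex:
      "\<And>v i. v \<in> V \<Longrightarrow> i \<in> {1..d} \<Longrightarrow> card {e \<in> incident_edges E v. i \<in> L e} \<le> k"
    and card_L_matching: "\<And>e i j. e \<in> E \<Longrightarrow> i \<in> {1..d} \<Longrightarrow> j \<in> {1..d} \<Longrightarrow>
      card {f \<in> edge_neighborhood E 6 e. h f = i \<and> j \<in> L f} \<le> k"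
    and few_at_vertex: "\<And>v. v \<in> V \<Longrightarrow> card {j \<in> {1..d}. \<rho> j \<in> L {v, nb j v}} < m"
    and few_opposite: "\<And>e. e \<in> E \<Longrightarrow> card {j \<in> opp_colors e. \<rho> j \<in> L (nb j ` e)} < m"
    and many_cycles: "\<And>e. e \<in> E \<Longrightarrow> m * (7 * k + 13 * m) + 5 * (k * d) < m * card (opp_colors e)"
begin

section \<open>Conflicts and the greedy invariant\<close>

definition conflicts :: "'a set set" where
  "conflicts = {e \<in> E. \<rho> (h e) \<in> L e}"

text \<open>Switching \<open>cyc e j\<close> gives \<open>e\<close> and its opposite edge the color
  \<open>\<rho> j\<close>, and the two other edges \<open>\<rho> (h e)\<close>. None of these four
  new colors may be forbidden.\<close>

definition allowed :: "'a set \<Rightarrow> nat \<Rightarrow> bool" where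
  "allowed e j \<longleftrightarrow> j \<in> opp_colors e \<and> \<rho> j \<notin> L e \<and> \<rho> j \<notin> L (nb j ` e) \<and>
     (\<forall>v\<in>e. \<rho> (h e) \<notin> L {v, nb j v})"

definition used :: "'a set set \<Rightarrow> ('a set \<Rightarrow> nat) \<Rightarrow> 'a set set" where
  "used D g = (\<Union>e\<in>D. cyc e (g e))"

text \<open>An edge \<open>e \<in> D\<close> with chosen color \<open>g e\<close> stands for the cycle \<open>cyc e (g e)\<close>.  Only visits of a
  cycle to vertices outside \<open>e\<close> need control: at its own endpoints \<open>e\<close> is one of fewer than \<open>m\<close>
  conflicts.  Likewise, cycles with \<open>h e = h f\<close> near \<open>f\<close> are bounded by sparsity on the matching.\<close>

definition passing :: "'a set set \<Rightarrow> ('a set \<Rightarrow> nat) \<Rightarrow> 'a \<Rightarrow> 'a set set" where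
  "passing D g v = {e \<in> D. v \<in> nb (g e) ` e - e}"

definition opposing :: "'a set set \<Rightarrow> ('a set \<Rightarrow> nat) \<Rightarrow> 'a set \<Rightarrow> 'a set set" where
  "opposing D g f =
     {e \<in> D. g e = h f \<and> (\<exists>x\<in>e. \<exists>l\<in>opp_colors f. {x, nb (g e) x} = nb l ` f)}"

text \<open>The invariant of the greedy choice. The two bounds by \<open>m\<close> limit how many
  chosen cycles can block a later conflict at a vertex or at an opposite edge.\<close>

definition good :: "'a set set \<Rightarrow> ('a set \<Rightarrow> nat) \<Rightarrow> bool" where
  "good D g \<longleftrightarrow> D \<subseteq> conflicts \<and> (\<forall>e\<in>D. allowed e (g e)) \<and>
     (\<forall>e\<in>D. \<forall>e'\<in>D. e \<noteq> e' \<longrightarrow> cyc e (g e) \<inter> cyc e' (g e') = {}) \<and>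
     (\<forall>v. card (passing D g v) \<le> m) \<and> (\<forall>f\<in>E. card (opposing D g f) \<le> m)"

definition near :: "'a set \<Rightarrow> 'a set set" where
  "near e = conflicts \<inter> edge_neighborhood E 6 e"

lemma finite_conflicts: "finite conflicts"
  using finite_E by (simp add: conflicts_def)

lemma conflict_edge: "e \<in> conflicts \<Longrightarrow> e \<in> E"
  by (simp add: conflicts_def)

lemma perm_range: "j \<in> {1..d} \<Longrightarrow> \<rho> j \<in> {1..d}"
  using permutes_in_image[OF perm] by blast

lemma nearI:
  assumes "f \<in> conflicts" "a \<in> e" "b \<in> f"
    and "a = x \<or> {a, x} \<in> E" "x = y \<or> {x, y} \<in> E" "y = b \<or> {y, b} \<in> E"
  shows "f \<in> near e"
  using edge_neighborhoodI[OF conflict_edge[OF assms(1)] assms(2-6), of 6] assms(1)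
  by (simp add: near_def)

lemma finite_near: "finite (near e)"
  using finite_conflicts by (simp add: near_def)

text \<open>All conflicts of color \<open>i\<close> have the one color \<open>\<rho> i\<close> in
  their lists, so a single instance of sparsity on the matching counts them, whatever
  \<open>\<rho>\<close> is.\<close>

lemma card_near_color:
  assumes "e \<in> E" "i \<in> {1..d}"
  shows "card {f \<in> near e. h f = i} \<le> k"
proof -
  have "{f \<in> near e. h f = i} \<subseteq> {f \<in> edge_neighborhood E 6 e. h f = i \<and> \<rho> i \<in> L f}"
    by (auto simp: near_def conflicts_def)
  moreover have "finite {f \<in> edge_neighborhood E 6 e. h f = i \<and> \<rho> i \<in> L f}"
    using finite_E by (simp add: edge_neighborhood_def)
  ultimately show ?thesis
    using card_L_matching[OF assms perm_range[OF assms(2)]] card_mono le_trans by meson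
qed

lemma card_near:
  assumes "e \<in> E"
  shows "card (near e) \<le> k * d"
proof -
  have "near e \<subseteq> (\<Union>i\<in>{1..d}. {f \<in> near e. h f = i})"
    using color_range by (auto simp: near_def conflicts_def)
  moreover have "finite (\<Union>i\<in>{1..d}. {f \<in> near e. h f = i})"
    using finite_near by auto
  ultimately have "card (near e) \<le> card (\<Union>i\<in>{1..d}. {f \<in> near e. h f = i})"
    by (rule card_mono[rotated])
  also have "\<dots> \<le> (\<Sum>i\<in>{1..d}. card {f \<in> near e. h f = i})" by (rule card_UN_le) simp
  also have "\<dots> \<le> (\<Sum>i\<in>{1..d}. k)" using card_near_color[OF assms] by (rule sum_mono)
  finally show ?thesis by (simp add: mult.commute)
qed

lemma inj_on_nb_color: "v \<in> V \<Longrightarrow> inj_on (\<lambda>j. nb j v) {1..d}"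
  by (rule inj_on_inverseI[where g = "\<lambda>w. h {v, w}"]) (rule nb_edge(2))

lemma card_conflicts_at_vertex:
  assumes "v \<in> V"
  shows "card {e \<in> conflicts. v \<in> e} < m"
proof -
  have "inj_on h {e \<in> conflicts. v \<in> e}"
    by (rule inj_onI) (use edge_eqI[of _ _ v] conflict_edge in auto)
  moreover have "h ` {e \<in> conflicts. v \<in> e} \<subseteq> {j \<in> {1..d}. \<rho> j \<in> L {v, nb j v}}"
    using color_range edge_eq_nb[of _ v] by (auto simp: conflicts_def)
  ultimately have "card {e \<in> conflicts. v \<in> e} \<le> card {j \<in> {1..d}. \<rho> j \<in> L {v, nb j v}}"
    by (rule card_inj_on_le) simp
  then show ?thesis using few_at_vertex[OF assms] by simp
qed

lemma goodD:
  assumes "good D g"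
  shows "D \<subseteq> conflicts" "finite D" "\<And>e. e \<in> D \<Longrightarrow> e \<in> E" "\<And>e. e \<in> D \<Longrightarrow> g e \<in> opp_colors e"
    "\<And>v. card (passing D g v) \<le> m" "\<And>f. f \<in> E \<Longrightarrow> card (opposing D g f) \<le> m"
  using assms finite_conflicts conflict_edge
  by (auto simp: good_def allowed_def intro: finite_subset)

section \<open>Counting the second colors to be avoided\<close>

lemma card_bad_own_list:
  assumes "e \<in> E"
  shows "card {j \<in> opp_colors e. \<rho> j \<in> L e} \<le> k"
proof -
  have "card {j \<in> opp_colors e. \<rho> j \<in> L e} \<le> card (L e)"
    by (rule card_inj_on_le[of \<rho>])
      (use permutes_inj[OF perm] finite_L[OF assms] in \<open>auto intro: inj_on_subset\<close>)
  then show ?thesis using card_L[OF assms] by simp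
qed

text \<open>Different \<open>j\<close> give different edges at \<open>v\<close>, all forbidding the
  same color \<open>\<rho> (h e)\<close>, so sparsity at \<open>v\<close> applies.\<close>

lemma card_bad_adjacent_list:
  assumes "e \<in> E" "v \<in> e"
  shows "card {j \<in> opp_colors e. \<rho> (h e) \<in> L {v, nb j v}} \<le> k"
proof -
  have v: "v \<in> V" using assms edge_vertex by blast
  have "inj_on (\<lambda>j. {v, nb j v}) {j \<in> opp_colors e. \<rho> (h e) \<in> L {v, nb j v}}"
    by (rule inj_on_inverseI[where g = h]) (use nb_edge(2)[OF v] opp_colorsD(1) in blast)
  moreover have "(\<lambda>j. {v, nb j v}) ` {j \<in> opp_colors e. \<rho> (h e) \<in> L {v, nb j v}}
      \<subseteq> {f \<in> incident_edges E v. \<rho> (h e) \<in> L f}"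
    using nb_edge(1)[OF v] opp_colorsD(1) by (auto simp: incident_edges_def)
  ultimately have "card {j \<in> opp_colors e. \<rho> (h e) \<in> L {v, nb j v}}
      \<le> card {f \<in> incident_edges E v. \<rho> (h e) \<in> L f}"
    by (rule card_inj_on_le) (use finite_E in \<open>simp add: incident_edges_def\<close>)
  then show ?thesis
    using card_L_vertex[OF v perm_range[OF color_range[OF assms(1)]]] by simp
qed

text \<open>A chosen cycle through \<open>v\<close> comes from a conflict at \<open>v\<close> (fewer
  than \<open>m\<close>) or passes \<open>v\<close> (at most \<open>m\<close>), and it blocks at
  most its two colors.\<close>

lemma card_bad_adjacent_used:
  assumes g: "good D g" and e: "e \<in> E" "v \<in> e"
  shows "card {j \<in> opp_colors e. {v, nb j v} \<in> used D g} \<le> 4 * m"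
proof -
  have v: "v \<in> V" using e edge_vertex by blast
  let ?D = "{e' \<in> conflicts. v \<in> e'} \<union> passing D g v"
  have fin: "finite ?D" using finite_conflicts goodD(2)[OF g] by (simp add: passing_def)
  have "{j \<in> opp_colors e. {v, nb j v} \<in> used D g} \<subseteq> (\<Union>e'\<in>?D. {h e', g e'})"
  proof
    fix j assume "j \<in> {j \<in> opp_colors e. {v, nb j v} \<in> used D g}"
    then obtain e' where j: "j \<in> opp_colors e" and e': "e' \<in> D" "{v, nb j v} \<in> cyc e' (g e')"
      by (auto simp: used_def)
    have "h {v, nb j v} = j" using nb_edge(2)[OF v opp_colorsD(1)[OF j]] .
    then have "j \<in> {h e', g e'}"
      using cyc_color[OF goodD(3,4)[OF g e'(1)] e'(2)] by auto
    moreover have "v \<in> e' \<union> nb (g e') ` e'"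
      using cyc_at_vertex(1)[OF goodD(3,4)[OF g e'(1)] e'(2)] by simp
    then have "e' \<in> ?D" using e'(1) goodD(1)[OF g] by (auto simp: passing_def)
    ultimately show "j \<in> (\<Union>e'\<in>?D. {h e', g e'})" by blast
  qed
  then have "card {j \<in> opp_colors e. {v, nb j v} \<in> used D g} \<le> card (\<Union>e'\<in>?D. {h e', g e'})"
    by (rule card_mono[rotated]) (use fin in auto)
  also have "\<dots> \<le> (\<Sum>e'\<in>?D. card {h e', g e'})" by (rule card_UN_le[OF fin])
  also have "\<dots> \<le> (\<Sum>e'\<in>?D. 2)" by (rule sum_mono) (simp add: card_insert_if)
  also have "\<dots> \<le> 2 * (card {e' \<in> conflicts. v \<in> e'} + card (passing D g v))"
    using card_Un_le[of "{e' \<in> conflicts. v \<in> e'}" "passing D g v"] by simp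
  also have "\<dots> \<le> 4 * m"
    using card_conflicts_at_vertex[OF v] goodD(5)[OF g, of v] by simp
  finally show ?thesis .
qed

lemma card_edge_union_image: "e \<in> E \<Longrightarrow> card (e \<union> f ` e) \<le> 4"
  using card_Un_le[of e "f ` e"] card_image_le[of e f] edge_card[of e] card_ge_0_finite[of e] by simp

text \<open>The map \<open>j \<mapsto> nb j ` e\<close> need not be injective (two colors may join \<open>e\<close> to the same
  opposite edge inside a \<open>K\<^sub>4\<close>), so the colors are counted through the endpoints \<open>nb j v\<close>.\<close>

lemma card_bad_opposite_used:
  assumes g: "good D g" and e: "e \<in> E"
  shows "card {j \<in> opp_colors e. nb j ` e \<in> used D g} \<le> 4 * (k + m)"
proof -
  obtain v where ve: "v \<in> e" using edge_card[OF e] by fastforce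
  have v: "v \<in> V" using e ve edge_vertex by blast
  \<comment> \<open>The edge opposite to \<open>e\<close> has color \<open>h e\<close>. On the cycle
    of \<open>e'\<close> this is either the color of \<open>e'\<close>, and then \<open>e'\<close>
    is one of at most \<open>k\<close> nearby conflicts of that color, or the second color, and then
    \<open>e'\<close> is in \<open>opposing D g e\<close>. Each cycle has at most four vertices to
    serve as \<open>nb j v\<close>.\<close>
  let ?D = "{e' \<in> near e. h e' = h e} \<inter> D \<union> opposing D g e"
  have DE: "e' \<in> D" if "e' \<in> ?D" for e' using that by (auto simp: opposing_def)
  have fin: "finite ?D" using goodD(2)[OF g] by (simp add: opposing_def)
  have sub: "(\<lambda>j. nb j v) ` {j \<in> opp_colors e. nb j ` e \<in> used D g}
      \<subseteq> (\<Union>e'\<in>?D. e' \<union> nb (g e') ` e')"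
  proof
    fix w assume "w \<in> (\<lambda>j. nb j v) ` {j \<in> opp_colors e. nb j ` e \<in> used D g}"
    then obtain j e' where j: "j \<in> opp_colors e" "w = nb j v"
      and e': "e' \<in> D" "nb j ` e \<in> cyc e' (g e')"
      by (auto simp: used_def)
    note E' = goodD(3,4)[OF g e'(1)]
    have conf: "e' \<in> conflicts" using e' goodD(1)[OF g] by blast
    have w: "w \<in> nb j ` e" "{v, w} \<in> E" using j ve nb_edge(1)[OF v opp_colorsD(1)[OF j(1)]] by auto
    then have w': "w \<in> e' \<union> nb (g e') ` e'" using cyc_at_vertex(1)[OF E' e'(2)] by blast
    from cyc_color[OF E' e'(2)] have "e' \<in> ?D"
    proof (elim disjE conjE)
      assume "h (nb j ` e) = h e'"
      then have "h e' = h e" using opp_colorsD(4)[OF j(1)] by simp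
      moreover have "e' \<in> near e"
      proof (cases "w \<in> e'")
        case True
        then show ?thesis using nearI[OF conf ve True, of w w] w by simp
      next
        case False
        then obtain x where x: "x \<in> e'" "w = nb (g e') x" using w' by blast
        then have "{w, x} \<in> E"
          using nb_edge(1)[of x "g e'"] edge_vertex[OF E'(1)] opp_colorsD(1)[OF E'(2)]
          by (simp add: insert_commute)
        then show ?thesis using nearI[OF conf ve x(1), of w w] w by simp
      qed
      ultimately show ?thesis using e' by simp
    next
      assume "h (nb j ` e) = g e'" "\<exists>v\<in>e'. nb j ` e = {v, nb (g e') v}"
      then have "e' \<in> opposing D g e"
        using e'(1) j(1) opp_colorsD(4)[OF j(1)] unfolding opposing_def by force
      then show ?thesis by simp
    qed
    then show "w \<in> (\<Union>e'\<in>?D. e' \<union> nb (g e') ` e')" using w' by blast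
  qed
  have fin': "finite (\<Union>e'\<in>?D. e' \<union> nb (g e') ` e')"
    using fin DE goodD(3)[OF g] edge_subset finite_V
    by (intro finite_UN_I) (auto intro!: finite_UnI finite_imageI dest: finite_subset[OF edge_subset])
  have "inj_on (\<lambda>j. nb j v) {j \<in> opp_colors e. nb j ` e \<in> used D g}"
    by (rule inj_on_subset[OF inj_on_nb_color[OF v]]) (auto simp: opp_colors_def)
  then have "card {j \<in> opp_colors e. nb j ` e \<in> used D g}
      \<le> card (\<Union>e'\<in>?D. e' \<union> nb (g e') ` e')"
    using sub fin' by (rule card_inj_on_le)
  also have "\<dots> \<le> (\<Sum>e'\<in>?D. card (e' \<union> nb (g e') ` e'))" by (rule card_UN_le[OF fin])
  also have "\<dots> \<le> (\<Sum>e'\<in>?D. 4)"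
    by (rule sum_mono) (use card_edge_union_image goodD(3)[OF g] DE in blast)
  also have "\<dots> = 4 * card ?D" by simp
  also have "card ?D \<le> card ({e' \<in> near e. h e' = h e} \<inter> D) + card (opposing D g e)"
    by (rule card_Un_le)
  also have "card ({e' \<in> near e. h e' = h e} \<inter> D) \<le> card {e' \<in> near e. h e' = h e}"
    using finite_near by (intro card_mono) auto
  also have "\<dots> \<le> k" using card_near_color[OF e color_range[OF e]] .
  also have "card (opposing D g e) \<le> m" using goodD(6)[OF g e] .
  finally show ?thesis by simp
qed

text \<open>Double counting of pairs of a color \<open>j\<close> and a conflict whose cycle passes
  \<open>nb j v\<close>. Such a conflict is near \<open>e\<close>, and it serves at most two colors
  because its opposite edge has two ends and \<open>j\<close> is determined by
  \<open>nb j v\<close>.\<close>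

lemma card_bad_crowded_vertex:
  assumes g: "good D g" and e: "e \<in> E" "v \<in> e"
  shows "m * card {j \<in> opp_colors e. m \<le> card (passing D g (nb j v))} \<le> 2 * (k * d)"
proof -
  have v: "v \<in> V" using e edge_vertex by blast
  let ?J = "{j \<in> opp_colors e. m \<le> card (passing D g (nb j v))}"
  let ?N = "near e \<inter> D"
  have "m * card ?J \<le> 2 * card ?N"
  proof (rule double_count_le[where R = "\<lambda>j e'. nb j v \<in> nb (g e') ` e' - e'"])
    show "finite ?J" using finite_opp_colors by simp
    show "finite ?N" using finite_near by simp
  next
    fix j assume j: "j \<in> ?J"
    then have w: "{v, nb j v} \<in> E" using nb_edge(1)[OF v] opp_colorsD(1) by blast
    have "passing D g (nb j v) \<subseteq> {e' \<in> ?N. nb j v \<in> nb (g e') ` e' - e'}"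
    proof
      fix e' assume "e' \<in> passing D g (nb j v)"
      then obtain x where e': "e' \<in> D" "nb j v \<in> nb (g e') ` e' - e'" "x \<in> e'" "nb j v = nb (g e') x"
        by (auto simp: passing_def)
      have "{nb j v, x} \<in> E"
        using nb_edge(1)[of x "g e'"] e' edge_vertex[OF goodD(3)[OF g e'(1)]]
          opp_colorsD(1)[OF goodD(4)[OF g e'(1)]] by (simp add: insert_commute)
      moreover have "e' \<in> conflicts" using e' goodD(1)[OF g] by blast
      ultimately have "e' \<in> near e" using nearI[OF _ e(2) e'(3), of "nb j v" "nb j v"] w by simp
      then show "e' \<in> {e' \<in> ?N. nb j v \<in> nb (g e') ` e' - e'}" using e' by simp
    qed
    then have "card (passing D g (nb j v)) \<le> card {e' \<in> ?N. nb j v \<in> nb (g e') ` e' - e'}"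
      using finite_near by (intro card_mono) auto
    then show "m \<le> card {e' \<in> ?N. nb j v \<in> nb (g e') ` e' - e'}" using j by simp
  next
    fix e' assume "e' \<in> ?N"
    then have e': "e' \<in> E" using goodD(3)[OF g] by blast
    then have fin: "finite e'" using edge_subset finite_V finite_subset by blast
    have "inj_on (\<lambda>j. nb j v) {j \<in> ?J. nb j v \<in> nb (g e') ` e' - e'}"
      by (rule inj_on_subset[OF inj_on_nb_color[OF v]]) (auto simp: opp_colors_def)
    then have "card {j \<in> ?J. nb j v \<in> nb (g e') ` e' - e'} \<le> card (nb (g e') ` e')"
      by (rule card_inj_on_le) (use fin in auto)
    also have "\<dots> \<le> 2" using card_image_le[OF fin] edge_card[OF e'] by metis
    finally show "card {j \<in> ?J. nb j v \<in> nb (g e') ` e' - e'} \<le> 2" .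
  qed
  also have "card ?N \<le> card (near e)" using finite_near by (intro card_mono) auto
  also have "\<dots> \<le> k * d" by (rule card_near[OF e(1)])
  finally show ?thesis by simp
qed

text \<open>The same double counting, where each nearby conflict serves only its own second
  color.\<close>

lemma card_bad_crowded_color:
  assumes e: "e \<in> E"
  shows "m * card {j \<in> opp_colors e. m \<le> card {e' \<in> near e \<inter> D. g e' = j}} \<le> k * d"
proof -
  let ?J = "{j \<in> opp_colors e. m \<le> card {e' \<in> near e \<inter> D. g e' = j}}"
  have "m * card ?J \<le> 1 * card (near e \<inter> D)"
  proof (rule double_count_le[where R = "\<lambda>j e'. g e' = j"])
    fix e'
    have "card {j \<in> ?J. g e' = j} \<le> card {g e'}" by (rule card_mono) auto
    then show "card {j \<in> ?J. g e' = j} \<le> 1" by simp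
  qed (use finite_opp_colors finite_near in auto)
  also have "card (near e \<inter> D) \<le> card (near e)" using finite_near by (intro card_mono) auto
  also have "\<dots> \<le> k * d" by (rule card_near[OF e])
  finally show ?thesis by simp
qed

lemma ex_admissible_color:
  assumes g: "good D g" and e: "e \<in> E"
  obtains j where "allowed e j" "cyc e j \<inter> used D g \<subseteq> {e}"
    "\<And>v. v \<in> e \<Longrightarrow> card (passing D g (nb j v)) < m" "card {e' \<in> near e \<inter> D. g e' = j} < m"
proof -
  define B1 where "B1 = {j \<in> opp_colors e. \<rho> j \<in> L e}"
  define B2 where "B2 v = {j \<in> opp_colors e. \<rho> (h e) \<in> L {v, nb j v}}" for v
  define B3 where "B3 = {j \<in> opp_colors e. \<rho> j \<in> L (nb j ` e)}"
  define B4 where "B4 v = {j \<in> opp_colors e. {v, nb j v} \<in> used D g}" for v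
  define B5 where "B5 = {j \<in> opp_colors e. nb j ` e \<in> used D g}"
  define B6 where "B6 v = {j \<in> opp_colors e. m \<le> card (passing D g (nb j v))}" for v
  define B7 where "B7 = {j \<in> opp_colors e. m \<le> card {e' \<in> near e \<inter> D. g e' = j}}"
  note defs = B1_def B2_def B3_def B4_def B5_def B6_def B7_def
  have fin: "finite B1" "finite (B2 v)" "finite B3" "finite (B4 v)" "finite B5" "finite (B6 v)" "finite B7" for v
    using finite_opp_colors unfolding defs by auto
  obtain u v where uv: "e = {u, v}" using edge_card[OF e] by (auto simp: card_2_iff)
  define B where "B = B1 \<union> (B2 u \<union> (B2 v \<union> (B3 \<union> (B4 u \<union> (B4 v \<union> (B5 \<union> (B6 u \<union> (B6 v \<union> B7))))))))"
  have "card B \<le> card B1 + (card (B2 u) + (card (B2 v) + (card B3 + (card (B4 u) + (card (B4 v) +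
      (card B5 + (card (B6 u) + (card (B6 v) + card B7))))))))"
    unfolding B_def by (intro order_trans[OF card_Un_le] add_left_mono order_refl)
  also have "\<dots> \<le> k + (k + (k + (m + (4 * m + (4 * m +
      (4 * (k + m) + (card (B6 u) + (card (B6 v) + card B7))))))))"
    using card_bad_own_list[OF e] card_bad_adjacent_list[OF e] few_opposite[OF e]
      card_bad_adjacent_used[OF g e] card_bad_opposite_used[OF g e]
    unfolding defs uv by (intro add_mono order_refl) (auto simp: less_imp_le)
  finally have "card B \<le> (7 * k + 13 * m) + (card (B6 u) + card (B6 v) + card B7)" by simp
  then have "m * card B \<le> m * ((7 * k + 13 * m) + (card (B6 u) + card (B6 v) + card B7))"
    by (rule mult_le_mono2)
  also have "\<dots> = m * (7 * k + 13 * m) + (m * card (B6 u) + m * card (B6 v) + m * card B7)"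
    by (simp add: distrib_left)
  also have "\<dots> \<le> m * (7 * k + 13 * m) + 5 * (k * d)"
  proof -
    have "m * card (B6 u) \<le> 2 * (k * d)" "m * card (B6 v) \<le> 2 * (k * d)" "m * card B7 \<le> k * d"
      using card_bad_crowded_vertex[OF g e] card_bad_crowded_color[OF e]
      unfolding B6_def B7_def uv by auto
    then show ?thesis by linarith
  qed
  also have "\<dots> < m * card (opp_colors e)" by (rule many_cycles[OF e])
  finally have "card B < card (opp_colors e)" by simp
  moreover have "finite B" using fin unfolding B_def by blast
  ultimately obtain j where j: "j \<in> opp_colors e" "j \<notin> B"
    using card_mono[of B "opp_colors e"] by fastforce
  show thesis
  proof (rule that[of j])
    show "allowed e j" using j unfolding B_def defs allowed_def uv by auto
    show "cyc e j \<inter> used D g \<subseteq> {e}" using j unfolding B_def defs cyc_def uv by auto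
    show "card (passing D g (nb j x)) < m" if "x \<in> e" for x
      using j that unfolding B_def defs uv by auto
    show "card {e' \<in> near e \<inter> D. g e' = j} < m" using j unfolding B_def defs by auto
  qed
qed

section \<open>Extending the family of cycles until no conflict is left\<close>

lemma good_extend:
  assumes g: "good D g" and e: "e \<in> conflicts" "e \<notin> used D g"
  obtains j where "good (insert e D) (g(e := j))" "e \<notin> D"
proof -
  have eE: "e \<in> E" using e conflict_edge by blast
  have eD: "e \<notin> D" using e by (auto simp: used_def cyc_def)
  obtain j where j: "allowed e j" "cyc e j \<inter> used D g \<subseteq> {e}"
    "\<And>v. v \<in> e \<Longrightarrow> card (passing D g (nb j v)) < m" "card {e' \<in> near e \<inter> D. g e' = j} < m"
    using ex_admissible_color[OF g eE] by blast
  have jo: "j \<in> opp_colors e" using j by (simp add: allowed_def)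
  let ?g = "g(e := j)"
  have gD: "?g e' = g e'" if "e' \<in> D" for e' using that eD by auto
  have disj: "cyc e j \<inter> cyc e' (g e') = {}" if "e' \<in> D" for e'
    using j(2) e(2) that unfolding used_def by blast
  \<comment> \<open>Only the vertices of the edge opposite to \<open>e\<close> can gain a passing
    cycle, and \<open>j\<close> was chosen so that each of them had fewer than
    \<open>m\<close>.\<close>
  have pass: "card (passing (insert e D) ?g v) \<le> m" for v
  proof (cases "v \<in> nb j ` e")
    case True
    have "passing (insert e D) ?g v \<subseteq> insert e (passing D g v)"
      using eD by (auto simp: passing_def)
    then have "card (passing (insert e D) ?g v) \<le> card (insert e (passing D g v))"
      using goodD(2)[OF g] by (intro card_mono) (auto simp: passing_def)
    also have "\<dots> \<le> Suc (card (passing D g v))" by (rule card_insert_le_m1) auto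
    also have "\<dots> \<le> m" using True j(3) by (auto simp: Suc_le_eq)
    finally show ?thesis .
  next
    case False
    then have "passing (insert e D) ?g v = passing D g v"
      using eD by (auto simp: passing_def)
    then show ?thesis using goodD(5)[OF g] by simp
  qed
  have opp: "card (opposing (insert e D) ?g f) \<le> m" if f: "f \<in> E" for f
  proof (cases "e \<in> opposing (insert e D) ?g f")
    case True
    then obtain x l where x: "j = h f" "x \<in> e" "l \<in> opp_colors f" "{x, nb j x} = nb l ` f"
      by (auto simp: opposing_def)
    have step: "\<exists>a\<in>f. {y, a} \<in> E" if "y \<in> nb i ` f" "i \<in> opp_colors f" for y i
      using that nb_edge(1)[of _ i] edge_vertex[OF f] opp_colorsD(1)[OF that(2)]
      by (auto simp: insert_commute)
    obtain a where a: "a \<in> f" "{x, a} \<in> E" using step[of x l] x by blast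
    \<comment> \<open>Once the new cycle opposes \<open>f\<close>, every other cycle opposing
      \<open>f\<close> has second color \<open>h f = j\<close>, and its conflict is near
      \<open>e\<close> along \<open>x\<close>, \<open>a\<close>, \<open>a'\<close>,
      \<open>x'\<close>. The bound on nearby uses of \<open>j\<close> therefore applies.\<close>
    have "opposing (insert e D) ?g f \<subseteq> insert e {e' \<in> near e \<inter> D. g e' = j}"
    proof
      fix e' assume e': "e' \<in> opposing (insert e D) ?g f"
      show "e' \<in> insert e {e' \<in> near e \<inter> D. g e' = j}"
      proof (cases "e' = e")
        case False
        then have "e' \<in> opposing D g f" using e' by (auto simp: opposing_def)
        then obtain x' l' where x': "e' \<in> D" "g e' = h f" "x' \<in> e'" "l' \<in> opp_colors f"
          "{x', nb (g e') x'} = nb l' ` f"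
          unfolding opposing_def by blast
        obtain a' where a': "a' \<in> f" "{x', a'} \<in> E" using step[of x' l'] x' by blast
        have "a = a' \<or> {a, a'} \<in> E"
          using a(1) a'(1) f edge_card[OF f] by (auto simp: card_2_iff insert_commute)
        then have "e' \<in> near e"
          using nearI[OF _ x(2) x'(3), of a a'] a a' goodD(1)[OF g] x'(1)
          by (auto simp: insert_commute)
        then show ?thesis using x' x by simp
      qed simp
    qed
    then have "card (opposing (insert e D) ?g f) \<le> card (insert e {e' \<in> near e \<inter> D. g e' = j})"
      using goodD(2)[OF g] by (intro card_mono) auto
    also have "\<dots> \<le> Suc (card {e' \<in> near e \<inter> D. g e' = j})" by (rule card_insert_le_m1) auto
    also have "\<dots> \<le> m" using j(4) by simp
    finally show ?thesis .
  next
    case False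
    then have "opposing (insert e D) ?g f \<subseteq> opposing D g f"
      using eD by (auto simp: opposing_def)
    then have "card (opposing (insert e D) ?g f) \<le> card (opposing D g f)"
      using goodD(2)[OF g] by (intro card_mono) (auto simp: opposing_def)
    then show ?thesis using goodD(6)[OF g f] by simp
  qed
  have "good (insert e D) ?g"
    unfolding good_def
  proof (intro conjI ballI allI impI)
    show "insert e D \<subseteq> conflicts" using e goodD(1)[OF g] by simp
    fix e1 assume e1: "e1 \<in> insert e D"
    then show "allowed e1 (?g e1)" using j(1) gD g by (auto simp: good_def)
    fix e2 assume e2: "e2 \<in> insert e D" "e1 \<noteq> e2"
    show "cyc e1 (?g e1) \<inter> cyc e2 (?g e2) = {}"
    proof (cases "e1 = e \<or> e2 = e")
      case True
      then show ?thesis using e1 e2 disj by (auto simp: Int_commute)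
    next
      case False
      then show ?thesis using e1 e2 g by (auto simp: good_def)
    qed
  qed (use pass opp in auto)
  then show thesis using that eD by blast
qed

text \<open>The greedy procedure appears as a \<open>good\<close> pair with \<open>card D\<close>
  maximal: by \<open>good_extend\<close> every conflict then lies on a chosen cycle. Edges on these
  cycles are safe by \<open>allowed\<close>; all others keep their color and are no
  conflicts.\<close>

lemma avoidable_lists: "avoidable E d L"
proof -
  have "\<exists>p. case_prod good p \<and> (\<forall>q. case_prod good q \<longrightarrow> card (fst q) \<le> card (fst p))"
  proof (rule Lattices_Big.ex_has_greatest_nat)
    show "case_prod good ({}, undefined)"
      by (simp add: good_def passing_def opposing_def)
    show "\<forall>p. case_prod good p \<longrightarrow> card (fst p) < Suc (card conflicts)"
      using card_mono[OF finite_conflicts goodD(1)] by (simp add: less_Suc_eq_le split_paired_all)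
  qed
  then obtain p where p: "case_prod good p" "\<forall>q. case_prod good q \<longrightarrow> card (fst q) \<le> card (fst p)"
    by (elim exE conjE)
  obtain D g where "p = (D, g)" by (cases p)
  then have g: "good D g" and max: "\<And>D' g'. good D' g' \<Longrightarrow> card D' \<le> card D"
    using p(1) p(2)[rule_format, of "(D', g')" for D' g'] by simp_all
  have covered: "e \<in> used D g" if e: "e \<in> conflicts" for e
  proof (rule ccontr)
    assume "e \<notin> used D g"
    then obtain j where "good (insert e D) (g(e := j))" "e \<notin> D"
      using good_extend[OF g e] by blast
    then show False using max[of "insert e D" "g(e := j)"] goodD(2)[OF g] by simp
  qed
  have sub: "D \<subseteq> E" using goodD(3)[OF g] by blast
  have disj: "cyc e (g e) \<inter> cyc e' (g e') = {}" if "e \<in> D" "e' \<in> D" "e \<noteq> e'" for e e'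
    using g that by (simp add: good_def)
  obtain \<sigma> where \<sigma>: "proper_d_edge_coloring E d \<sigma>"
    and out: "\<And>f. f \<in> E \<Longrightarrow> f \<notin> (\<Union>e\<in>D. cyc e (g e)) \<Longrightarrow> \<sigma> f = h f"
    and inn: "\<And>e f. e \<in> D \<Longrightarrow> f \<in> cyc e (g e) \<Longrightarrow> \<sigma> f = (if h f = h e then g e else h e)"
    using switch_disjoint_cycles[OF sub goodD(4)[OF g] disj] by blast
  have "proper_d_edge_coloring E d (\<rho> \<circ> \<sigma>)"
    using \<sigma> perm_range permutes_inj[OF perm]
    by (auto simp: proper_d_edge_coloring_def proper_edge_coloring_def inj_eq image_subset_iff)
  moreover have "\<rho> (\<sigma> f) \<notin> L f" if f: "f \<in> E" for f
  proof (cases "f \<in> used D g")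
    case True
    then obtain e where e: "e \<in> D" "f \<in> cyc e (g e)" by (auto simp: used_def)
    then have "allowed e (g e)" using g by (simp add: good_def)
    moreover have "g e \<noteq> h e" using opp_colorsD(2)[OF goodD(4)[OF g e(1)]] .
    ultimately show ?thesis
      using cyc_color[OF goodD(3,4)[OF g e(1)] e(2)] inn[OF e] by (auto simp: allowed_def)
  next
    case False
    then have "f \<notin> conflicts" "\<sigma> f = h f" using covered out[OF f] by (auto simp: used_def)
    then show ?thesis using f by (simp add: conflicts_def)
  qed
  ultimately show ?thesis unfolding avoidable_def by fastforce
qed

end

section \<open>Choice of the permutation and conclusion\<close>

theorem corollary1p4:
  fixes V :: "'a set" and E :: "'a set set" and d s n :: nat
    and h :: "'a set \<Rightarrow> nat" and c :: real and L :: "'a set \<Rightarrow> nat set"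
  assumes "ds_edge_colorable V E d s"
    and "card V = n"
    and "standard_coloring E d s h"
    and "s \<ge> 11"
    and "c > 0"
    and "1 / 2 * (2 powi (-11) * inverse c * real s ^ 2 * inverse (real d))
           powr (2 powi (-9) * inverse (real d) * real s ^ 2) \<ge> real n"
    and "list_assignment E d L"
    and "sparse_assignment V E d s h (c / real s) L"
  shows "avoidable E d L"
proof -
  have proper: "proper_d_edge_coloring E d h"
    using assms(3) by (simp add: standard_coloring_def)
  interpret factorized_graph V E d h
    using assms(1) proper by unfold_locales (simp_all add: ds_edge_colorable_def)
  have cs: "c / real s * real s = c" using assms(4) by simp
  have L_sub: "L e \<subseteq> {1..d}" if "e \<in> E" for e
    using assms(7) that by (simp add: list_assignment_def)
  have finite_L: "finite (L e)" if "e \<in> E" for e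
    using L_sub[OF that] finite_subset by blast
  have sparse1: "real (card (L e)) \<le> c" if "e \<in> E" for e
    using assms(8) that unfolding sparse_assignment_def cs by blast
  have sparse2: "real (card {e \<in> incident_edges E v. i \<in> L e}) \<le> c" if "v \<in> V" "i \<in> {1..d}" for v i
    using assms(8) that unfolding sparse_assignment_def cs by blast
  have sparse3: "real (card {f \<in> edge_neighborhood E 6 e. h f = i \<and> j \<in> L f}) \<le> c"
    if "e \<in> E" "i \<in> {1..d}" "j \<in> {1..d}" for e i j
  proof -
    have "standard_matching E d h {f \<in> E. h f = i}"
      using that unfolding standard_matching_def by blast
    then have "real (card {f \<in> {f \<in> E. h f = i} \<inter> edge_neighborhood E 6 e. j \<in> L f}) \<le> c"
      using assms(8) that unfolding sparse_assignment_def cs by blast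
    moreover have "{f \<in> {f \<in> E. h f = i} \<inter> edge_neighborhood E 6 e. j \<in> L f}
        = {f \<in> edge_neighborhood E 6 e. h f = i \<and> j \<in> L f}"
      by (auto simp: edge_neighborhood_def)
    ultimately show ?thesis by simp
  qed
  have opp: "s - 1 \<le> card (opp_colors e)" if "e \<in> E" for e
    using assms(3) card_opp_colors[of e] that unfolding standard_coloring_def by fastforce
  \<comment> \<open>If c < 1 all lists are empty and \<open>h\<close> itself works. In the last case
    the edge yields \<open>2 \<le> n\<close> and \<open>0 < d\<close>, which
    \<open>parameter_bounds\<close> requires besides \<open>1 \<le> c\<close>.\<close>
  consider "E = {}" | "c < 1" | e where "e \<in> E" "1 \<le> c" by fastforce
  then show ?thesis
  proof cases
    case 1
    then show ?thesis
      by (simp add: avoidable_def proper_d_edge_coloring_def proper_edge_coloring_def)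
  next
    case 2
    have "L e = {}" if "e \<in> E" for e
    proof -
      have "real (card (L e)) < 1" using sparse1[OF that] 2 by linarith
      then show ?thesis using finite_L[OF that] by simp
    qed
    then show ?thesis using proper by (auto simp: avoidable_def)
  next
    case 3
    define k where "k = nat \<lfloor>c\<rfloor>"
    define m where "m = s div 16"
    have le_k: "x \<le> k" if "real x \<le> c" for x
      using that le_nat_floor by (simp add: k_def)
    have n2: "2 \<le> n"
      using card_mono[OF finite_V edge_subset[OF 3(1)]] edge_card[OF 3(1)] assms(2) by simp
    have d0: "0 < d" using color_range[OF 3(1)] by simp
    have "card (opp_colors e) \<le> card ({1..d} - {h e})"
      by (rule card_mono) (auto simp: opp_colors_def)
    then have "s - 1 \<le> d - 1" using opp[OF 3(1)] color_range[OF 3(1)] by simp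
    then have sd: "s \<le> d" using d0 by linarith
    note bounds = parameter_bounds[OF n2 3(2) d0 sd assms(6) k_def m_def]
    \<comment> \<open>One event per vertex, counting conflicts there, and one per edge, counting
      cycles bad at the opposite edge. The empty set for other \<open>j\<close> restricts the count
      to \<open>opp_colors e\<close>.\<close>
    define A where "A = case_sum (\<lambda>v j. L {v, nb j v})
      (\<lambda>e j. if j \<in> opp_colors e then L (nb j ` e) else {})"
    \<comment> \<open>The number of events is at most n + n (n - 1) / 2 <= n^2.\<close>
    have "n * (n - 1) + n = n * n" using n2 by (simp add: algebra_simps)
    then have "n + card E \<le> n ^ 2"
      using card_E le_square[of n] unfolding assms(2) power2_eq_square by linarith
    then have "card (V <+> E) \<le> n ^ 2"
      using assms(2) finite_V finite_E by (simp add: card_Plus)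
    then have "card (V <+> E) * k ^ m \<le> n ^ 2 * k ^ m" by (rule mult_le_mono1)
    also note bounds(1)
    finally have few: "card (V <+> E) * k ^ m < fact m" .
    have A: "finite (A i j) \<and> card (A i j) \<le> k" if "i \<in> V <+> E" "j \<in> {1..d}" for i j
    proof (cases i)
      case (Inl v)
      then have "{v, nb j v} \<in> E" using that nb_edge(1) by auto
      then show ?thesis using Inl finite_L le_k[OF sparse1] by (simp add: A_def)
    next
      case (Inr e)
      then show ?thesis using opp_colorsD(3)[of j e] finite_L le_k[OF sparse1] by (simp add: A_def)
    qed
    have fin: "finite {1..d}" "finite (V <+> E)" using finite_V finite_E by simp_all
    obtain \<rho> where \<rho>: "\<rho> permutes {1..d}"
      and hits: "\<And>i. i \<in> V <+> E \<Longrightarrow> card {j \<in> {1..d}. \<rho> j \<in> A i j} < m"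
      by (rule exists_permutation_few_hits[OF fin _ few, where A = A])
        (rule A, assumption+, rule that, assumption, simp only:)
    interpret sparse_conflicts V E d h L \<rho> k m
    proof
      show "\<rho> permutes {1..d}" by (rule \<rho>)
      show "card {j \<in> {1..d}. \<rho> j \<in> L {v, nb j v}} < m" if "v \<in> V" for v
        using hits[OF InlI[OF that]] by (simp add: A_def)
      show "card {j \<in> opp_colors e. \<rho> j \<in> L (nb j ` e)} < m" if "e \<in> E" for e
      proof -
        have "{j \<in> opp_colors e. \<rho> j \<in> L (nb j ` e)} = {j \<in> {1..d}. \<rho> j \<in> A (Inr e) j}"
          by (auto simp: A_def opp_colors_def)
        then show ?thesis using hits[OF InrI[OF that]] by simp
      qed
      show "m * (7 * k + 13 * m) + 5 * (k * d) < m * card (opp_colors e)" if "e \<in> E" for e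
        using bounds(2) mult_le_mono2[OF opp[OF that], of m] by linarith
    qed (use finite_L le_k[OF sparse1] le_k[OF sparse2] le_k[OF sparse3] in auto)
    show ?thesis by (rule avoidable_lists)
  qed
qed

end
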